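(* Let $\lambda>0$, let $z_1,\dots,z_n\in\mathbb R$, $\mathbf A_1,\dots,\mathbf A_n\in\mathbb R^p$, and let $i_0=2^{j_0}+1$ for some integer $j_0\ge0$. If $(\hat\beta_n,\hat\theta_n)\in\mathbb R^p\times\mathbb R^n$ is a solution of the optimization problem $$(\hat\beta_n,\hat\theta_n)=\operatorname*{argmin}_{(\beta,\theta)}\left\{J_n(\beta,\theta)=\sum_{i=1}^n\frac12(z_i-\mathbf A_i^T\beta-\theta_i)^2+\lambda\sum_{i=i_0}^n|\theta_i|\right\},$$ then $$\hat\beta_n=\operatorname*{argmin}_{\beta}\sum_{i=i_0}^n\rho_\lambda(z_i-\mathbf A_i^T\beta),$$ $$\hat\theta_{i,n}=\begin{cases} z_i-\mathbf A_i^T\hat\beta_n & \text{if } i<i_0,\\ \gamma_{soft,\lambda}(z_i-\mathbf A_i^T\hat\beta_n) & \text{if } i\ge i_0,\end{cases}\qquad i=1,\dots,n,$$ where $\rho_\lambda$ is Huber's cost functional with threshold $\lambda$ and $\gamma_{soft,\lambda}$ is the soft-thresholding function with threshold $\lambda$.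
   Context: Huber's cost functional: $\rho_\lambda(u)=u^2/2$ if $|u|\le\lambda$, and $\rho_\lambda(u)=\lambda|u|-\lambda^2/2$ if $|u|>\lambda$. Soft thresholding: $\gamma_{soft,\lambda}(u)=\operatorname{sign}(u)(|u|-\lambda)_+$. "$x=\operatorname{argmin} F$" means that $x$ is a minimizer of $F$. In the application, $z_i$ and $\mathbf A_i^T$ are the $i$th component of $\mathbf Z=W\mathbf Y$ and the $i$th row of $A=WX$, where $W$ is an orthogonal $n\times n$ discrete wavelet transform matrix ($n=2^J$) with primary resolution level $j_0$ (its first $2^{j_0}$ rows giving the scaling coefficients), $\mathbf Y$ is the response vector and $X$ the $n\times p$ design matrix of a partially linear model. *)

theory Defs
  imports "HOL-Analysis.Analysis"
begin

definition huber :: "real \<Rightarrow> real \<Rightarrow> real" where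
  "huber lam u = (if \<bar>u\<bar> \<le> lam then u\<^sup>2 / 2 else lam * \<bar>u\<bar> - lam\<^sup>2 / 2)"

definition soft_threshold :: "real \<Rightarrow> real \<Rightarrow> real" where
  "soft_threshold lam u = sgn u * max 0 (\<bar>u\<bar> - lam)"

text \<open>Observations are indexed by \<open>1, \<dots>, n\<close>. The space \<open>R^n\<close> is the set of
  extensional functions on \<open>{1..n}\<close>, so that the coordinate order is that of the natural numbers;
  \<open>z\<close> and \<open>A\<close> are only evaluated at indices in \<open>{1..n}\<close>.\<close>

definition Rn :: "nat \<Rightarrow> (nat \<Rightarrow> real) set" where
  "Rn n = {1..n} \<rightarrow>\<^sub>E UNIV"

definition penalized_objective ::
  "nat \<Rightarrow> nat \<Rightarrow> real \<Rightarrow> (nat \<Rightarrow> real) \<Rightarrow> (nat \<Rightarrow> real ^ 'p) \<Rightarrow>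
   real ^ 'p \<Rightarrow> (nat \<Rightarrow> real) \<Rightarrow> real" where
  "penalized_objective n i0 lam z A \<beta> \<theta> =
     (\<Sum>i = 1..n. 1 / 2 * (z i - A i \<bullet> \<beta> - \<theta> i)\<^sup>2) + lam * (\<Sum>i = i0..n. \<bar>\<theta> i\<bar>)"

end

theory Submission imports Defs begin

text \<open>For fixed \<open>\<beta>\<close> the objective separates over the coordinates of \<open>\<theta>\<close>. The map
  \<open>t \<mapsto> (u - t)\<^sup>2 / 2 + lam * \<bar>t\<bar>\<close> is strongly convex with minimizer the
  soft threshold of \<open>u\<close> and minimum the Huber cost of \<open>u\<close> (its Moreau envelope), so it exceeds its minimum
  by at least half the squared distance to the minimizer. Minimizing over \<open>\<theta>\<close> first thus leaves the Huber
  criterion in \<open>\<beta>\<close>, and the quadratic excess forces \<open>\<theta>\<close> to be the thresholded residual.\<close>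

lemma huber_soft_threshold_le:
  assumes "lam > 0"
  shows "huber lam u + (t - soft_threshold lam u)\<^sup>2 / 2 \<le> (u - t)\<^sup>2 / 2 + lam * \<bar>t\<bar>"
proof -
  consider "\<bar>u\<bar> \<le> lam" | "u > lam" | "u < - lam" by linarith
  then show ?thesis
  proof cases
    case 1
    \<comment> \<open>The threshold is 0 here, so after expanding the squares only this bound on the
      cross term remains.\<close>
    have "u * t \<le> \<bar>u\<bar> * \<bar>t\<bar>" by (metis abs_ge_self abs_mult)
    also have "\<dots> \<le> lam * \<bar>t\<bar>" using 1 by (intro mult_right_mono) auto
    finally have "u * t \<le> lam * \<bar>t\<bar>" .
    moreover have "huber lam u = u\<^sup>2 / 2" "soft_threshold lam u = 0"
      using 1 by (simp_all add: huber_def soft_threshold_def)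
    ultimately show ?thesis by (simp only: power2_diff) (simp add: field_simps)
  next
    case 2
    \<comment> \<open>Expanding \<open>(t - (u - lam))\<^sup>2\<close> turns the left side of the
      claim into \<open>(u - t)\<^sup>2 / 2 + lam * t\<close>.\<close>
    have "lam * t \<le> lam * \<bar>t\<bar>" using assms by (intro mult_left_mono) auto
    moreover have "huber lam u = lam * u - lam\<^sup>2 / 2" "soft_threshold lam u = u - lam"
      using 2 assms by (simp_all add: huber_def soft_threshold_def)
    ultimately show ?thesis by (simp only:) (simp add: power2_eq_square field_simps)
  next
    case 3
    have "lam * (- t) \<le> lam * \<bar>t\<bar>" using assms by (intro mult_left_mono) auto
    moreover have "huber lam u = - lam * u - lam\<^sup>2 / 2" "soft_threshold lam u = u + lam"
      using 3 assms by (simp_all add: huber_def soft_threshold_def)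
    ultimately show ?thesis by (simp only:) (simp add: power2_eq_square field_simps)
  qed
qed

text \<open>Shows that the lower bound above is attained at the soft threshold, where the excess
  vanishes.\<close>

lemma huber_eq_soft_threshold:
  assumes "lam > 0"
  shows "huber lam u = (u - soft_threshold lam u)\<^sup>2 / 2 + lam * \<bar>soft_threshold lam u\<bar>"
proof -
  consider "\<bar>u\<bar> \<le> lam" | "u > lam" | "u < - lam" by linarith
  then show ?thesis
  proof cases
    case 1
    then show ?thesis by (simp add: huber_def soft_threshold_def)
  next
    case 2
    then have "huber lam u = lam * u - lam\<^sup>2 / 2" "soft_threshold lam u = u - lam"
      using assms by (simp_all add: huber_def soft_threshold_def)
    then show ?thesis using 2 by (simp only:) (simp add: power2_eq_square field_simps)
  next
    case 3
    then have "huber lam u = - lam * u - lam\<^sup>2 / 2" "soft_threshold lam u = u + lam"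
      using assms by (simp_all add: huber_def soft_threshold_def)
    then show ?thesis using 3 by (simp only:) (simp add: power2_eq_square field_simps)
  qed
qed

text \<open>Padding with zeros puts fit and penalty over the same index set, so that they can be
  compared term by term.\<close>

lemma sum_tail_eq_sum_if:
  fixes f :: "nat \<Rightarrow> real"
  assumes "i0 \<ge> 1"
  shows "(\<Sum>i = i0..n. f i) = (\<Sum>i = 1..n. if i < i0 then 0 else f i)"
  using assms by (intro sum.mono_neutral_cong_left) auto

definition best_theta :: "nat \<Rightarrow> real \<Rightarrow> real \<Rightarrow> nat \<Rightarrow> real" where
  "best_theta i0 lam u i = (if i < i0 then u else soft_threshold lam u)"

lemma penalized_objective_eq_sum:
  assumes "i0 \<ge> 1"
  shows "penalized_objective n i0 lam z A \<beta> \<theta> =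
    (\<Sum>i = 1..n. (z i - A i \<bullet> \<beta> - \<theta> i)\<^sup>2 / 2 + (if i < i0 then 0 else lam * \<bar>\<theta> i\<bar>))"
  unfolding penalized_objective_def sum_distrib_left sum_tail_eq_sum_if[OF assms] sum.distrib
  by (intro arg_cong2[where f = "(+)"] sum.cong) auto

text \<open>Coordinates below \<open>i0\<close> carry no penalty and give equality; the others use
  the quadratic excess, which is kept because it later identifies \<theta>.\<close>

lemma penalized_objective_ge:
  assumes "lam > 0" "i0 \<ge> 1"
  shows "(\<Sum>i = i0..n. huber lam (z i - A i \<bullet> \<beta>)) +
      (\<Sum>i = 1..n. (\<theta> i - best_theta i0 lam (z i - A i \<bullet> \<beta>) i)\<^sup>2 / 2)
    \<le> penalized_objective n i0 lam z A \<beta> \<theta>"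
  unfolding penalized_objective_eq_sum[OF assms(2)] sum_tail_eq_sum_if[OF assms(2)]
    sum.distrib[symmetric]
proof (intro sum_mono)
  fix i
  show "(if i < i0 then 0 else huber lam (z i - A i \<bullet> \<beta>)) +
      (\<theta> i - best_theta i0 lam (z i - A i \<bullet> \<beta>) i)\<^sup>2 / 2
    \<le> (z i - A i \<bullet> \<beta> - \<theta> i)\<^sup>2 / 2 + (if i < i0 then 0 else lam * \<bar>\<theta> i\<bar>)"
    using huber_soft_threshold_le[OF assms(1), of "z i - A i \<bullet> \<beta>" "\<theta> i"]
    by (simp add: best_theta_def power2_commute)
qed

lemma penalized_objective_best_theta:
  assumes "lam > 0" "i0 \<ge> 1"
  shows "penalized_objective n i0 lam z A \<beta>
      (\<lambda>i\<in>{1..n}. best_theta i0 lam (z i - A i \<bullet> \<beta>) i)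
    = (\<Sum>i = i0..n. huber lam (z i - A i \<bullet> \<beta>))"
  unfolding penalized_objective_eq_sum[OF assms(2)] sum_tail_eq_sum_if[OF assms(2)]
  by (intro sum.cong) (simp_all add: best_theta_def huber_eq_soft_threshold[OF assms(1)])

theorem proposition1:
  fixes lam :: real and n j0 i0 :: nat
    and z :: "nat \<Rightarrow> real" and A :: "nat \<Rightarrow> real ^ 'p"
    and \<beta>h :: "real ^ 'p" and \<theta>h :: "nat \<Rightarrow> real"
  assumes "lam > 0"
    and "i0 = 2 ^ j0 + 1"
    and "is_arg_min (\<lambda>(\<beta>, \<theta>). penalized_objective n i0 lam z A \<beta> \<theta>)
           (\<lambda>(\<beta>, \<theta>). \<theta> \<in> Rn n) (\<beta>h, \<theta>h)"
  shows "is_arg_min (\<lambda>\<beta>. \<Sum>i = i0..n. huber lam (z i - A i \<bullet> \<beta>)) (\<lambda>\<beta>. True) \<beta>h \<and>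
    (\<forall>i \<in> {1..n}. \<theta>h i =
      (if i < i0 then z i - A i \<bullet> \<beta>h else soft_threshold lam (z i - A i \<bullet> \<beta>h)))"
proof -
  have i0: "i0 \<ge> 1" using assms(2) by simp
  define H where "H \<beta> = (\<Sum>i = i0..n. huber lam (z i - A i \<bullet> \<beta>))" for \<beta>
  define d where "d i = (\<theta>h i - best_theta i0 lam (z i - A i \<bullet> \<beta>h) i)\<^sup>2 / 2" for i
  \<comment> \<open>Each \<beta> is paired with its own best \<theta>, so joint optimality becomes a
    comparison of Huber criteria.\<close>
  have key: "H \<beta>h + sum d {1..n} \<le> H \<beta>" for \<beta>
  proof -
    let ?\<theta> = "\<lambda>i\<in>{1..n}. best_theta i0 lam (z i - A i \<bullet> \<beta>) i"
    have "H \<beta>h + sum d {1..n} \<le> penalized_objective n i0 lam z A \<beta>h \<theta>h"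
      unfolding H_def d_def by (rule penalized_objective_ge[OF assms(1) i0])
    also have "\<dots> \<le> penalized_objective n i0 lam z A \<beta> ?\<theta>"
    proof -
      \<comment> \<open>Restricting to \<open>{1..n}\<close> makes the competitor extensional, hence
        feasible.\<close>
      have "?\<theta> \<in> Rn n" by (simp add: Rn_def)
      then show ?thesis using assms(3) by (auto simp: is_arg_min_linorder)
    qed
    also have "\<dots> = H \<beta>"
      unfolding H_def by (rule penalized_objective_best_theta[OF assms(1) i0])
    finally show ?thesis .
  qed
  have d_nonneg: "d i \<ge> 0" for i by (simp add: d_def)
  then have sum_d_nonneg: "sum d {1..n} \<ge> 0" by (intro sum_nonneg)
  \<comment> \<open>Comparing \<beta>h with itself cancels the Huber terms and leaves a nonpositive
    excess.\<close>
  with key[of \<beta>h] have "sum d {1..n} = 0" by linarith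
  then have "\<forall>i\<in>{1..n}. d i = 0" using d_nonneg by (simp add: sum_nonneg_eq_0_iff)
  then have "\<forall>i\<in>{1..n}. \<theta>h i = best_theta i0 lam (z i - A i \<bullet> \<beta>h) i"
    by (simp add: d_def)
  moreover have "H \<beta>h \<le> H \<beta>" for \<beta>
    using key[of \<beta>] sum_d_nonneg by linarith
  ultimately show ?thesis
    by (simp add: is_arg_min_linorder H_def best_theta_def)
qed

end
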